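(* (Reciprocity theorem on hypergraphs.) Let $I$ be a finite set and let $H$ be a hypergraph over $I$. Then for every nonnegative integer $n$, $(-1)^{|I|}\chi_I(H)(-n)$ is the number of pairs $(f,S)$ where $f$ is an acyclic orientation of $H$, $S$ is a coloring of $H$ with $[n]$, and $f$ and $S$ are compatible. In particular, $(-1)^{|I|}\chi_I(H)(-1)=|\mathcal{A}_H|$ is the number of acyclic orientations of $H$.
   Context: Notation: $[n]=\{1,\dots,n\}$. A decomposition of a finite set $I$ of length $n$ is a sequence $(S_1,\dots,S_n)$ of pairwise disjoint (possibly empty) sets with union $I$. Hypergraphs. A hypergraph $H$ over a finite set $I$ is a finite multiset of (possibly repeated) subsets of $I$, called edges, containing $\emptyset$ exactly once. Elements of $I$ are vertices. For $I=S\sqcup T$, the restriction $H_{|S}$ is the multiset $\{e\in H: e\subseteq S\}$ (a hypergraph over $S$) and the contraction $H_{/S}$ is the multiset $\{e\cap T: e\in H,\ e\nsubseteq S\}\cup\{\emptyset\}$ (a hypergraph over $T$), multiplicities being kept. The Hopf monoid of hypergraphs has product given by union of edges ($H_1\otimes H_2\mapsto H_1\sqcup H_2$, with $\emptyset$ kept once) and coproduct $\Delta_{S,T}(H)=H_{|S}\otimes H_{/S}$. The iterated coproduct along a decomposition $(S_1,\dots,S_n)$ of $I$ is $\Delta_{S_1,\dots,S_n}(H)=H_1\otimes\cdots\otimes H_n$ with $H_i=(H_{|S_1\sqcup\cdots\sqcup S_i})_{/S_1\sqcup\cdots\sqcup S_{i-1}}$. Basic invariant. A hypergraph is discrete if all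 its edges have cardinality at most $1$. Let $\zeta(H)=1$ if $H$ is discrete and $\zeta(H)=0$ otherwise. For a nonnegative integer $n$, $$\chi_I(H)(n)=\sum_{(S_1,\dots,S_n)}\zeta(H_1)\cdots\zeta(H_n),$$ the sum being over all decompositions of $I$ of length $n$, with $\Delta_{S_1,\dots,S_n}(H)=H_1\otimes\cdots\otimes H_n$. It is known that $\chi_I(H)(n)$ is a polynomial in $n$; $\chi_I(H)(-n)$ denotes the value of this polynomial at $-n$. Colorings and orientations. A coloring of $H$ with $[n]$ is a function $S:I\to[n]$. An orientation of $H$ is a function $f$ assigning to each nonempty edge $e$ of $H$ (repeated edges being treated as distinct elements) a vertex $f(e)\in e$. A directed cycle of $f$ is a sequence of distinct edges $e_1,\dots,e_k$ with $f(e_1)\in e_2\setminus\{f(e_2)\},\dots,f(e_{k-1})\in e_k\setminus\{f(e_k)\},\ f(e_k)\in e_1\setminus\{f(e_1)\}$. The orientation is acyclic if it has no directed cycle, and $\mathcal{A}_H$ is the set of acyclic orientations of $H$. An orientation $f$ and a coloring $S$ are compatible if $S(f(e))=\max S(e)$ for every nonempty edge $e\in H$. *)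

theory Defs
  imports
    "HOL-Library.Multiset"
    "HOL-Library.FuncSet"
    "HOL-Computational_Algebra.Polynomial"
begin

section \<open>Hypergraphs\<close>

definition hypergraph :: "'a set \<Rightarrow> 'a set multiset \<Rightarrow> bool" where
  "hypergraph I H \<longleftrightarrow> finite I \<and> (\<forall>e\<in>#H. e \<subseteq> I) \<and> count H {} = 1"

definition hg_restrict :: "'a set \<Rightarrow> 'a set multiset \<Rightarrow> 'a set multiset" where
  "hg_restrict S H = {#e \<in># H. e \<subseteq> S#}"

text \<open>\<open>hg_contract S T H\<close> is the contraction of a hypergraph over \<open>S \<union> T\<close> (with \<open>S\<close>, \<open>T\<close>
  disjoint) by \<open>S\<close>; it is a hypergraph over \<open>T\<close>.\<close>

definition hg_contract :: "'a set \<Rightarrow> 'a set \<Rightarrow> 'a set multiset \<Rightarrow> 'a set multiset" where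
  "hg_contract S T H = {#e \<inter> T. e \<in># {#e \<in># H. \<not> e \<subseteq> S#}#} + {#{}#}"

definition decompositions :: "'a set \<Rightarrow> nat \<Rightarrow> 'a set list set" where
  "decompositions I n =
     {Ss. length Ss = n \<and> (\<forall>i<n. \<forall>j<n. i \<noteq> j \<longrightarrow> Ss ! i \<inter> Ss ! j = {}) \<and> \<Union>(set Ss) = I}"

text \<open>With 0-based indices, the \<open>i\<close>-th factor is the restriction to the union of the first
  \<open>i + 1\<close> parts, contracted by the union of the first \<open>i\<close> parts.\<close>

definition iterated_coproduct :: "'a set list \<Rightarrow> 'a set multiset \<Rightarrow> 'a set multiset list" where
  "iterated_coproduct Ss H =
     map (\<lambda>i. hg_contract (\<Union>(set (take i Ss))) (Ss ! i)
                (hg_restrict (\<Union>(set (take (Suc i) Ss))) H))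
       [0..<length Ss]"


section \<open>The basic invariant\<close>

definition discrete_hg :: "'a set multiset \<Rightarrow> bool" where
  "discrete_hg H \<longleftrightarrow> (\<forall>e\<in>#H. card e \<le> 1)"

definition zeta :: "'a set multiset \<Rightarrow> rat" where
  "zeta H = (if discrete_hg H then 1 else 0)"

definition chi :: "'a set \<Rightarrow> 'a set multiset \<Rightarrow> nat \<Rightarrow> rat" where
  "chi I H n = (\<Sum>Ss\<in>decompositions I n. prod_list (map zeta (iterated_coproduct Ss H)))"

text \<open>The polynomial interpolating \<^term>\<open>chi I H\<close>; it exists and is unique, see
  \<open>chi_poly_ex1\<close> and \<open>poly_chi_poly\<close> below.\<close>

definition chi_poly :: "'a set \<Rightarrow> 'a set multiset \<Rightarrow> rat poly" where
  "chi_poly I H = (THE p. \<forall>n. poly p (of_nat n) = chi I H n)"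


section \<open>Orientations and colorings\<close>

text \<open>The nonempty edges of \<open>H\<close>, where the copies of a repeated edge \<open>e\<close> are told apart as
  \<open>(e, 0), \<dots>, (e, count H e - 1)\<close>.\<close>

definition edges :: "'a set multiset \<Rightarrow> ('a set \<times> nat) set" where
  "edges H = {(e, i). e \<noteq> {} \<and> i < count H e}"

text \<open>Orientations and colorings are extensional functions, so that they can be counted.\<close>

definition orientations :: "'a set multiset \<Rightarrow> ('a set \<times> nat \<Rightarrow> 'a) set" where
  "orientations H = (\<Pi>\<^sub>E x\<in>edges H. fst x)"

definition directed_cycle ::
    "'a set multiset \<Rightarrow> ('a set \<times> nat \<Rightarrow> 'a) \<Rightarrow> ('a set \<times> nat) list \<Rightarrow> bool" where
  "directed_cycle H f es \<longleftrightarrow>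
     es \<noteq> [] \<and> distinct es \<and> set es \<subseteq> edges H \<and>
     (\<forall>i<length es. let e' = es ! (Suc i mod length es) in f (es ! i) \<in> fst e' - {f e'})"

definition acyclic_orientations :: "'a set multiset \<Rightarrow> ('a set \<times> nat \<Rightarrow> 'a) set" where
  "acyclic_orientations H = {f \<in> orientations H. \<nexists>es. directed_cycle H f es}"

definition colorings :: "'a set \<Rightarrow> nat \<Rightarrow> ('a \<Rightarrow> nat) set" where
  "colorings I n = I \<rightarrow>\<^sub>E {1..n}"

definition compatible ::
    "'a set multiset \<Rightarrow> ('a set \<times> nat \<Rightarrow> 'a) \<Rightarrow> ('a \<Rightarrow> nat) \<Rightarrow> bool" where
  "compatible H f S \<longleftrightarrow> (\<forall>x\<in>edges H. S (f x) = Max (S ` fst x))"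


section \<open>Polynomiality of the invariant\<close>

lemma sum_powers_poly: "\<exists>p :: rat poly. \<forall>n. (\<Sum>j<n. of_nat j ^ k) = poly p (of_nat n)"
proof (induction k rule: less_induct)
  case (less k)
  then obtain P :: "nat \<Rightarrow> rat poly"
    where P: "\<And>i n. i < k \<Longrightarrow> (\<Sum>j<n. of_nat j ^ i) = poly (P i) (of_nat n)"
    by metis
  have tele: "(of_nat n :: rat) ^ Suc k = (\<Sum>j<n. \<Sum>i\<le>k. of_nat (Suc k choose i) * of_nat j ^ i)"
    for n
  proof (induction n)
    case (Suc n)
    have "(of_nat (Suc n) :: rat) ^ Suc k = (of_nat n + 1) ^ Suc k"
      by (simp add: add.commute)
    also have "\<dots> = (\<Sum>i\<le>Suc k. of_nat (Suc k choose i) * of_nat n ^ i)"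
      by (simp only: binomial_ring power_one mult_1_right)
    also have "\<dots> = of_nat n ^ Suc k + (\<Sum>i\<le>k. of_nat (Suc k choose i) * of_nat n ^ i)"
      by (simp only: sum.atMost_Suc binomial_n_n of_nat_1 mult_1_left add.commute)
    finally show ?case using Suc by (simp only: sum.lessThan_Suc)
  qed simp
  define p where "p = smult (1 / of_nat (Suc k))
     (monom 1 (Suc k) - (\<Sum>i<k. smult (of_nat (Suc k choose i)) (P i)))"
  have "(\<Sum>j<n. of_nat j ^ k) = poly p (of_nat n)" for n
  proof -
    have "(of_nat n :: rat) ^ Suc k
        = (\<Sum>i\<le>k. of_nat (Suc k choose i) * (\<Sum>j<n. of_nat j ^ i))"
      unfolding tele by (subst sum.swap) (simp add: sum_distrib_left)
    also have "\<dots> = (\<Sum>i<k. of_nat (Suc k choose i) * poly (P i) (of_nat n))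
        + of_nat (Suc k) * (\<Sum>j<n. of_nat j ^ k)"
      by (simp add: lessThan_Suc_atMost[symmetric] P del: of_nat_Suc)
    finally have eq: "(of_nat n :: rat) ^ Suc k = \<dots>" .
    have "poly p (of_nat n) = (of_nat n ^ Suc k
        - (\<Sum>i<k. of_nat (Suc k choose i) * poly (P i) (of_nat n))) / of_nat (Suc k)"
      by (simp add: p_def poly_monom poly_sum del: of_nat_Suc power_Suc)
    also have "\<dots> = (\<Sum>j<n. of_nat j ^ k)"
      unfolding eq by (simp del: of_nat_Suc)
    finally show ?thesis by simp
  qed
  then show ?case by blast
qed

lemma sum_poly_poly:
  fixes q :: "rat poly"
  shows "\<exists>p. \<forall>n. (\<Sum>j<n. poly q (of_nat j)) = poly p (of_nat n)"
proof -
  obtain P :: "nat \<Rightarrow> rat poly"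
    where P: "\<And>i n. (\<Sum>j<n. of_nat j ^ i) = poly (P i) (of_nat n)"
    using sum_powers_poly by metis
  have "(\<Sum>j<n. poly q (of_nat j)) = poly (\<Sum>i\<le>degree q. smult (coeff q i) (P i)) (of_nat n)" for n
    unfolding poly_altdef[of q]
    by (subst sum.swap) (simp add: poly_sum P[symmetric] sum_distrib_left)
  then show ?thesis by blast
qed

lemma finite_decompositions: "finite I \<Longrightarrow> finite (decompositions I n)"
  by (rule finite_subset[OF _ finite_lists_length_eq[of "Pow I" n]])
     (auto simp: decompositions_def)

lemma decompositions_Suc:
  "decompositions I (Suc n) = (\<Union>S\<in>Pow I. (\<lambda>Ss. Ss @ [I - S]) ` decompositions S n)"
proof (intro equalityI subsetI)
  fix Ts assume Ts: "Ts \<in> decompositions I (Suc n)"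
  then have len: "length Ts = Suc n" by (simp add: decompositions_def)
  then obtain Ss T where eq: "Ts = Ss @ [T]" by (metis length_Suc_conv_rev)
  with len have n: "length Ss = n" by simp
  have disj: "Ts ! i \<inter> Ts ! j = {}" if "i < Suc n" "j < Suc n" "i \<noteq> j" for i j
    using Ts that by (simp add: decompositions_def)
  have un: "\<Union>(set Ss) \<union> T = I"
    using Ts by (auto simp: decompositions_def eq)
  have d1: "Ss ! i \<inter> Ss ! j = {}" if "i < n" "j < n" "i \<noteq> j" for i j
    using disj[of i j] that n by (simp add: eq nth_append)
  have d2: "Ss ! i \<inter> T = {}" if "i < n" for i
    using disj[of i n] that n by (simp add: eq nth_append)
  have "\<Union>(set Ss) \<inter> T = {}"
    using d2 n by (fastforce simp: in_set_conv_nth)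
  with un have "T = I - \<Union>(set Ss)" by blast
  moreover have "Ss \<in> decompositions (\<Union>(set Ss)) n"
    using d1 n by (simp add: decompositions_def)
  ultimately show "Ts \<in> (\<Union>S\<in>Pow I. (\<lambda>Ss. Ss @ [I - S]) ` decompositions S n)"
    using un eq by blast
next
  fix Ts assume "Ts \<in> (\<Union>S\<in>Pow I. (\<lambda>Ss. Ss @ [I - S]) ` decompositions S n)"
  then obtain S Ss where S: "S \<subseteq> I" and Ss: "Ss \<in> decompositions S n" and eq: "Ts = Ss @ [I - S]"
    by blast
  have n: "length Ss = n" and un: "\<Union>(set Ss) = S"
    and d: "\<And>i j. i < n \<Longrightarrow> j < n \<Longrightarrow> i \<noteq> j \<Longrightarrow> Ss ! i \<inter> Ss ! j = {}"
    using Ss by (auto simp: decompositions_def)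
  have d2: "Ss ! i \<inter> (I - S) = {}" if "i < n" for i
    using nth_mem[of i Ss] un n that by blast
  have "Ts ! i \<inter> Ts ! j = {}" if "i < Suc n" "j < Suc n" "i \<noteq> j" for i j
  proof -
    consider "i < n" "j < n" | "i < n" "j = n" | "i = n" "j < n"
      using \<open>i < Suc n\<close> \<open>j < Suc n\<close> \<open>i \<noteq> j\<close> by linarith
    then show ?thesis
      using d[of i j] d2[of i] d2[of j] n \<open>i \<noteq> j\<close>
      by cases (simp_all add: eq nth_append Int_commute)
  qed
  then show "Ts \<in> decompositions I (Suc n)"
    using n un S by (auto simp: decompositions_def eq)
qed

lemma hg_restrict_restrict:
  "S \<subseteq> T \<Longrightarrow> hg_restrict S (hg_restrict T H) = hg_restrict S H"
  by (auto simp: hg_restrict_def filter_filter_mset intro!: filter_mset_cong)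

lemma hypergraph_restrict: "hypergraph I H \<Longrightarrow> S \<subseteq> I \<Longrightarrow> hypergraph S (hg_restrict S H)"
  by (auto simp: hypergraph_def hg_restrict_def intro: finite_subset)

lemma hypergraph_contract:
  assumes H: "hypergraph I H" and I: "I = S \<union> T" "S \<inter> T = {}"
  shows "hypergraph T (hg_contract S T H)"
proof -
  have "{} \<notin># {#e \<inter> T. e \<in># {#e \<in># H. \<not> e \<subseteq> S#}#}"
    using H I by (auto simp: hypergraph_def)
  then show ?thesis
    using H I by (auto simp: hypergraph_def hg_contract_def not_in_iff)
qed

lemma hg_restrict_self: "hypergraph I H \<Longrightarrow> hg_restrict I H = H"
  by (simp add: hypergraph_def hg_restrict_def filter_mset_eq_conv)

lemma iterated_coproduct_snoc:
  assumes H: "hypergraph I H" and S: "S \<subseteq> I" and Ss: "\<Union>(set Ss) = S"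
  shows "iterated_coproduct (Ss @ [I - S]) H
     = iterated_coproduct Ss (hg_restrict S H) @ [hg_contract S (I - S) H]"
proof -
  have sub: "\<Union>(set (take m Ss)) \<subseteq> S" for m
    using Ss by (auto dest: in_set_takeD)
  have un: "S \<union> I = I" "I \<union> S = I" using S by blast+
  show ?thesis
    using sub Ss S
    by (simp add: iterated_coproduct_def nth_append hg_restrict_restrict un
        hg_restrict_self[OF H])
qed

lemma chi_Suc:
  assumes H: "hypergraph I H"
  shows "chi I H (Suc n)
    = (\<Sum>S\<in>Pow I. chi S (hg_restrict S H) n * zeta (hg_contract S (I - S) H))"
proof -
  have fin: "finite I" using H by (simp add: hypergraph_def)
  have inj: "inj_on (\<lambda>Ss. Ss @ [I - S]) A" for S and A :: "'a set list set"
    by (auto simp: inj_on_def)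
  have "chi I H (Suc n) = (\<Sum>S\<in>Pow I. \<Sum>Ts\<in>(\<lambda>Ss. Ss @ [I - S]) ` decompositions S n.
      prod_list (map zeta (iterated_coproduct Ts H)))"
    unfolding chi_def decompositions_Suc
  proof (rule sum.UNION_disjoint)
    show "\<forall>S\<in>Pow I. finite ((\<lambda>Ss. Ss @ [I - S]) ` decompositions S n)"
      using fin by (auto intro!: finite_imageI finite_decompositions intro: finite_subset)
    show "\<forall>S\<in>Pow I. \<forall>S'\<in>Pow I. S \<noteq> S' \<longrightarrow>
       (\<lambda>Ss. Ss @ [I - S]) ` decompositions S n \<inter> (\<lambda>Ss. Ss @ [I - S']) ` decompositions S' n = {}"
      by (auto simp: decompositions_def)
  qed (use fin in simp)
  also have "\<dots> = (\<Sum>S\<in>Pow I. \<Sum>Ss\<in>decompositions S n.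
      prod_list (map zeta (iterated_coproduct (Ss @ [I - S]) H)))"
    by (simp add: sum.reindex[OF inj])
  also have "\<dots> = (\<Sum>S\<in>Pow I. chi S (hg_restrict S H) n * zeta (hg_contract S (I - S) H))"
    unfolding chi_def sum_distrib_right
  proof (intro sum.cong refl)
    fix S Ss assume "S \<in> Pow I" "Ss \<in> decompositions S n"
    then show "prod_list (map zeta (iterated_coproduct (Ss @ [I - S]) H))
        = prod_list (map zeta (iterated_coproduct Ss (hg_restrict S H))) * zeta (hg_contract S (I - S) H)"
      by (subst iterated_coproduct_snoc[OF H]) (auto simp: decompositions_def)
  qed
  finally show ?thesis .
qed

lemma chi_is_poly: "hypergraph I H \<Longrightarrow> \<exists>p. \<forall>n. poly p (of_nat n) = chi I H n"
proof (induction "card I" arbitrary: I H rule: less_induct)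
  case less
  note H = \<open>hypergraph I H\<close>
  have fin: "finite I" using H by (simp add: hypergraph_def)
  have "\<exists>p. \<forall>n. poly p (of_nat n) = chi S (hg_restrict S H) n" if "S \<in> Pow I - {I}" for S
    using that fin
    by (intro less.hyps hypergraph_restrict[OF H] psubset_card_mono) auto
  then obtain P where
    P: "\<And>S n. S \<in> Pow I - {I} \<Longrightarrow> poly (P S) (of_nat n) = chi S (hg_restrict S H) n"
    by metis
  define q where "q = (\<Sum>S\<in>Pow I - {I}. smult (zeta (hg_contract S (I - S) H)) (P S))"
  have "hg_contract I {} H = {#{}#}"
  proof -
    have "{#e \<in># H. \<not> e \<subseteq> I#} = {#}" using H by (auto simp: hypergraph_def)
    then show ?thesis by (simp add: hg_contract_def)
  qed
  then have z1: "zeta (hg_contract I {} H) = 1"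
    by (simp add: zeta_def discrete_hg_def)
  have step: "chi I H (Suc n) = chi I H n + poly q (of_nat n)" for n
  proof -
    have "chi I H (Suc n) = chi I H n
       + (\<Sum>S\<in>Pow I - {I}. chi S (hg_restrict S H) n * zeta (hg_contract S (I - S) H))"
      unfolding chi_Suc[OF H] using fin
      by (subst sum.remove[of _ I]) (simp_all add: z1 hg_restrict_self[OF H])
    then show ?thesis by (simp add: q_def poly_sum P mult.commute)
  qed
  obtain p where p: "\<And>n. (\<Sum>j<n. poly q (of_nat j)) = poly p (of_nat n)"
    using sum_poly_poly by metis
  have *: "chi I H n = chi I H 0 + (\<Sum>j<n. poly q (of_nat j))" for n
    by (induction n) (simp_all add: step)
  have "poly ([:chi I H 0:] + p) (of_nat n) = chi I H n" for n
    unfolding *[of n] by (simp add: p)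
  then show ?case by blast
qed

lemma chi_poly_ex1:
  assumes "hypergraph I H"
  shows "\<exists>!p. \<forall>n. poly p (of_nat n) = chi I H n"
proof (rule ex_ex1I)
  show "\<exists>p. \<forall>n. poly p (of_nat n) = chi I H n"
    using assms by (rule chi_is_poly)
next
  fix p q assume "\<forall>n. poly p (of_nat n) = chi I H n" "\<forall>n. poly q (of_nat n) = chi I H n"
  then have "range of_nat \<subseteq> {x. poly (p - q) x = 0}" by auto
  moreover have "infinite (range (of_nat :: nat \<Rightarrow> rat))"
    by (simp add: finite_image_iff inj_on_def)
  ultimately have "infinite {x. poly (p - q) x = 0}"
    using finite_subset by blast
  then show "p = q"
    using poly_roots_finite[of "p - q"] by auto
qed

theorem poly_chi_poly:
  "hypergraph I H \<Longrightarrow> poly (chi_poly I H) (of_nat n) = chi I H n"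
  unfolding chi_poly_def using theI'[OF chi_poly_ex1] by blast

end

theory Submission imports Defs begin

text \<open>Both sides obey one recursion that determines them by induction on \<open>card I\<close> and \<open>n\<close>.
  Splitting off the last part \<open>T = I - S\<close> of a decomposition gives
  \<open>\<chi>\<^sub>I(x + 1) = \<Sum>\<^sub>S \<zeta>(H\<^sub>/\<^sub>S) \<chi>\<^sub>S(x)\<close> as polynomials, hence at \<open>x = -n - 1\<close>, after multiplication by
  \<open>(-1)\<close> to the power \<open>card I\<close>,
  \<open>g\<^sub>I(n) = \<Sum>\<^sub>S (-1)\<^bsup>card T\<^esup> \<zeta>(H\<^sub>/\<^sub>S) g\<^sub>S(n + 1)\<close>.
  For the number of compatible pairs this is inclusion-exclusion: a compatible pair on \<open>H\<^sub>|\<^sub>S\<close> with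
  \<open>n + 1\<close> colors is the same as one on \<open>H\<close> in which every vertex of \<open>T\<close> has color \<open>n + 1\<close> and is
  selected by every edge through it, and by acyclicity a pair has no such vertex exactly if the
  color \<open>n + 1\<close> is not used.\<close>

section \<open>Compatible pairs, top sinks and finiteness\<close>

definition compatible_pairs ::
    "'a set \<Rightarrow> 'a set multiset \<Rightarrow> nat \<Rightarrow> (('a set \<times> nat \<Rightarrow> 'a) \<times> ('a \<Rightarrow> nat)) set" where
  "compatible_pairs I H n =
     {(f, c). f \<in> acyclic_orientations H \<and> c \<in> colorings I n \<and> compatible H f c}"

text \<open>Draw an arc from each vertex of an edge to the vertex that the edge selects. A vertex
  selected by all edges through it, or lying in no edge, has no arc to another vertex, hence the
  name sink; \<open>n\<close> is meant to be the largest available color.\<close>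

definition top_sinks ::
    "'a set \<Rightarrow> 'a set multiset \<Rightarrow> nat \<Rightarrow> (('a set \<times> nat \<Rightarrow> 'a) \<times> ('a \<Rightarrow> nat)) \<Rightarrow> 'a set" where
  "top_sinks I H n = (\<lambda>(f, c). {v \<in> I. c v = n \<and> (\<forall>x\<in>edges H. v \<in> fst x \<longrightarrow> f x = v)})"

lemma finite_edges: "finite (edges H)"
proof -
  have "edges H \<subseteq> (SIGMA e : set_mset H. {..<count H e})"
    by (auto simp: edges_def simp flip: count_greater_zero_iff)
  then show ?thesis by (rule finite_subset) auto
qed

lemma edges_restrict: "edges (hg_restrict S H) = {x \<in> edges H. fst x \<subseteq> S}"
  by (auto simp: edges_def hg_restrict_def split: if_splits)

lemma edges_subset: "hypergraph I H \<Longrightarrow> x \<in> edges H \<Longrightarrow> fst x \<subseteq> I"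
  by (auto simp: edges_def hypergraph_def simp flip: count_greater_zero_iff)

lemma finite_fst_edges: "hypergraph I H \<Longrightarrow> x \<in> edges H \<Longrightarrow> finite (fst x)"
  using edges_subset[of I H x] by (auto simp: hypergraph_def intro: finite_subset)

lemma finite_orientations: "hypergraph I H \<Longrightarrow> finite (orientations H)"
  unfolding orientations_def by (rule finite_PiE[OF finite_edges]) (rule finite_fst_edges)

lemma finite_compatible_pairs:
  assumes "hypergraph I H"
  shows "finite (compatible_pairs I H n)"
proof (rule finite_subset)
  show "compatible_pairs I H n \<subseteq> orientations H \<times> colorings I n"
    by (auto simp: compatible_pairs_def acyclic_orientations_def)
  show "finite (orientations H \<times> colorings I n)"
    using assms by (auto simp: colorings_def hypergraph_def intro!: finite_orientations finite_PiE)
qed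

section \<open>Sinks of acyclic orientations\<close>

text \<open>An orbit in a finite set must repeat. Minimality of the period keeps the points of one
  round apart, which is what the distinct edges of a directed cycle will need.\<close>

lemma ex_minimal_period:
  assumes "finite C" "C \<noteq> {}" "h ` C \<subseteq> C"
  obtains u k where "u \<in> C" "k > 0" "(h ^^ k) u = u" "inj_on (\<lambda>i. (h ^^ i) u) {..<k}"
proof -
  obtain v where v: "v \<in> C" using assms by blast
  have mem: "(h ^^ i) v \<in> C" for i using assms v by (induction i) auto
  have "\<not> inj (\<lambda>i. (h ^^ i) v)"
  proof
    assume "inj (\<lambda>i. (h ^^ i) v)"
    moreover have "finite (range (\<lambda>i. (h ^^ i) v))"
      by (rule finite_subset[OF _ assms(1)]) (use mem in blast)
    ultimately show False using finite_imageD infinite_UNIV_nat by blast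
  qed
  then obtain i j where "i < j" and eq: "(h ^^ i) v = (h ^^ j) v"
    unfolding inj_def by (metis linorder_neqE_nat)
  \<comment> \<open>The orbit of \<open>v\<close> may enter its periodic part late; \<open>u\<close>
    already lies on that part.\<close>
  define u where "u = (h ^^ i) v"
  have "(h ^^ (j - i)) u = (h ^^ (j - i + i)) v"
    unfolding u_def funpow_add by simp
  then have "(h ^^ (j - i)) u = u" using \<open>i < j\<close> eq by (simp add: u_def)
  then have ex: "\<exists>k. k > 0 \<and> (h ^^ k) u = u" using \<open>i < j\<close> by (intro exI[of _ "j - i"]) auto
  define k where "k = (LEAST k. k > 0 \<and> (h ^^ k) u = u)"
  have k: "k > 0" "(h ^^ k) u = u" using LeastI_ex[OF ex] unfolding k_def by auto
  have least: "\<not> (l > 0 \<and> (h ^^ l) u = u)" if "l < k" for l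
    using not_less_Least[of l "\<lambda>k. k > 0 \<and> (h ^^ k) u = u"] that unfolding k_def by blast
  have "(h ^^ a) u \<noteq> (h ^^ b) u" if "a < b" "b < k" for a b
  proof
    assume "(h ^^ a) u = (h ^^ b) u"
    \<comment> \<open>Applying \<open>h\<close> another \<open>k - b\<close> times to a collision at
      \<open>a < b\<close> gives the period \<open>k - b + a\<close>, which is below
      \<open>k\<close>.\<close>
    then have "(h ^^ (k - b + a)) u = (h ^^ (k - b + b)) u" unfolding funpow_add by simp
    moreover have "k - b + b = k" "0 < k - b + a" "k - b + a < k" using that by linarith+
    ultimately show False using least[of "k - b + a"] k by simp
  qed
  then have "inj_on (\<lambda>i. (h ^^ i) u) {..<k}"
    by (intro inj_onI) (metis lessThan_iff linorder_neqE_nat)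
  then show ?thesis using that k mem u_def by blast
qed

text \<open>If every vertex of \<open>C\<close> had an edge through it selecting another vertex,
  moving to that selected vertex would map \<open>C\<close> to itself, by \<open>closed\<close>. A
  periodic orbit of this map would be a directed cycle.\<close>

lemma acyclic_orientation_ex_sink:
  assumes f: "f \<in> acyclic_orientations H" and C: "finite C" "C \<noteq> {}"
    and closed: "\<And>x v. x \<in> edges H \<Longrightarrow> v \<in> fst x \<Longrightarrow> v \<in> C \<Longrightarrow> f x \<in> C"
  obtains v where "v \<in> C" "\<forall>x\<in>edges H. v \<in> fst x \<longrightarrow> f x = v"
proof -
  have False if "\<forall>v\<in>C. \<exists>x\<in>edges H. v \<in> fst x \<and> f x \<noteq> v"
  proof -
    from that obtain g where g: "\<And>v. v \<in> C \<Longrightarrow> g v \<in> edges H \<and> v \<in> fst (g v) \<and> f (g v) \<noteq> v"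
      by metis
    define h where "h v = f (g v)" for v
    have hC: "h ` C \<subseteq> C" using g closed by (fastforce simp: h_def)
    obtain u k where u: "u \<in> C" and k: "k > 0" and per: "(h ^^ k) u = u"
      and inj: "inj_on (\<lambda>i. (h ^^ i) u) {..<k}"
      using ex_minimal_period[OF C hC] .
    define w where "w i = (h ^^ i) u" for i
    have wC: "w i \<in> C" for i using u hC by (induction i) (auto simp: w_def)
    have wSuc: "f (g (w i)) = w (Suc i)" for i by (simp add: w_def h_def)
    have wmod: "w (Suc i mod k) = w (Suc i)" if "i < k" for i
      using that per k by (cases "Suc i = k") (simp_all add: w_def)
    \<comment> \<open>Equal edges select equal vertices, and the selected vertices are the orbit
      points shifted by one, which are distinct modulo the period \<open>k\<close>.\<close>
    have "inj_on (\<lambda>i. g (w i)) {..<k}"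
    proof (rule inj_onI)
      fix i j assume ij: "i \<in> {..<k}" "j \<in> {..<k}" and "g (w i) = g (w j)"
      then have "w (Suc i mod k) = w (Suc j mod k)" using wSuc wmod by (metis lessThan_iff)
      then have "Suc i mod k = Suc j mod k"
        using inj k by (auto simp: w_def inj_on_def)
      then show "i = j" using ij by (auto simp: mod_Suc split: if_splits)
    qed
    moreover have "w (Suc i) \<in> fst (g (w (Suc i)))" "w (Suc i) \<noteq> w (Suc (Suc i))" for i
      using g[OF wC[of "Suc i"]] wSuc[of "Suc i"] by auto
    moreover have "g (w i) \<in> edges H" for i using g[OF wC] by blast
    ultimately have "directed_cycle H f (map (\<lambda>i. g (w i)) [0..<k])"
      using k by (auto simp: directed_cycle_def distinct_map Let_def wSuc wmod atLeast0LessThan)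
    then show False using f by (auto simp: acyclic_orientations_def)
  qed
  then show ?thesis using that by blast
qed

text \<open>By compatibility an edge selects a vertex of maximal color, so the vertices of color
  \<open>Suc n\<close> are closed under moving to a selected vertex. If there are any, one of them
  is a sink, hence a top sink.\<close>

lemma compatible_pairs_Suc_no_top_sinks:
  assumes H: "hypergraph I H"
  shows "{p \<in> compatible_pairs I H (Suc n). top_sinks I H (Suc n) p = {}} = compatible_pairs I H n"
proof (intro equalityI subsetI)
  fix p assume p: "p \<in> compatible_pairs I H n"
  then show "p \<in> {p \<in> compatible_pairs I H (Suc n). top_sinks I H (Suc n) p = {}}"
    by (fastforce simp: compatible_pairs_def top_sinks_def colorings_def PiE_iff)
next
  fix p assume "p \<in> {p \<in> compatible_pairs I H (Suc n). top_sinks I H (Suc n) p = {}}"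
  then obtain f c where p: "p = (f, c)" and f: "f \<in> acyclic_orientations H"
    and c: "c \<in> colorings I (Suc n)" and comp: "compatible H f c"
    and no: "top_sinks I H (Suc n) (f, c) = {}"
    by (auto simp: compatible_pairs_def)
  define C where "C = {v \<in> I. c v = Suc n}"
  have "C = {}"
  proof (rule ccontr)
    assume "C \<noteq> {}"
    have "f x \<in> C" if x: "x \<in> edges H" "v \<in> fst x" "v \<in> C" for x v
    proof -
      have "f x \<in> fst x"
        using f x by (auto simp: acyclic_orientations_def orientations_def PiE_iff)
      then have fI: "f x \<in> I" using edges_subset[OF H x(1)] by blast
      have "c v \<le> c (f x)"
        using comp x finite_fst_edges[OF H x(1)] by (simp add: compatible_def)
      moreover have "c (f x) \<le> Suc n" using c fI by (auto simp: colorings_def PiE_iff)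
      ultimately show ?thesis using fI x by (simp add: C_def)
    qed
    moreover have "finite C" using H by (simp add: C_def hypergraph_def)
    ultimately obtain v where "v \<in> C" "\<forall>x\<in>edges H. v \<in> fst x \<longrightarrow> f x = v"
      using acyclic_orientation_ex_sink[OF f _ \<open>C \<noteq> {}\<close>] by metis
    then show False using no by (auto simp: top_sinks_def C_def)
  qed
  then have "c \<in> colorings I n"
    using c by (fastforce simp: C_def colorings_def PiE_iff le_Suc_eq)
  then show "p \<in> compatible_pairs I H n"
    using p f comp by (simp add: compatible_pairs_def)
qed

section \<open>Restriction to \<open>S\<close> and extension by top sinks\<close>

lemma zeta_contract:
  "zeta (hg_contract S T H) = (if \<forall>e\<in>#H. \<not> e \<subseteq> S \<longrightarrow> card (e \<inter> T) \<le> 1 then 1 else 0)"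
  by (auto simp: zeta_def discrete_hg_def hg_contract_def)

text \<open>Demanding that all vertices outside \<open>S\<close> be top sinks fixes their color and
  the choice of every edge meeting them, so restriction loses nothing. Conversely these forced
  values extend any pair on \<open>S\<close>: by \<open>disc\<close> an edge has at most one vertex
  outside \<open>S\<close> to select, and \<open>n > 0\<close> makes \<open>n\<close> a legal
  color.\<close>

lemma bij_betw_compatible_pairs_restrict:
  assumes H: "hypergraph I H" and S: "S \<subseteq> I" and n: "n > 0"
    and disc: "\<And>x. x \<in> edges H \<Longrightarrow> card (fst x \<inter> (I - S)) \<le> 1"
  shows "bij_betw (\<lambda>(f, c). (restrict f (edges (hg_restrict S H)), restrict c S))
     {p \<in> compatible_pairs I H n. I - S \<subseteq> top_sinks I H n p}
     (compatible_pairs S (hg_restrict S H) n)"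
proof -
  let ?E = "edges H" and ?E' = "edges (hg_restrict S H)" and ?T = "I - S"
  \<comment> \<open>The inverse map: an edge not inside \<open>S\<close> selects its only vertex
    outside \<open>S\<close>, and vertices outside \<open>S\<close> get the top color.\<close>
  define extf where
    "extf f = (\<lambda>x\<in>?E. if fst x \<subseteq> S then f x else the_elem (fst x \<inter> ?T))" for f :: "'a set \<times> nat \<Rightarrow> 'a"
  define extc where "extc c = (\<lambda>v\<in>I. if v \<in> S then c v else n)" for c :: "'a \<Rightarrow> nat"
  have single: "fst x \<inter> ?T = {v}" if "x \<in> ?E" "v \<in> fst x" "v \<in> ?T" for x v
  proof -
    have "finite (fst x \<inter> ?T)" using finite_fst_edges[OF H that(1)] by simp
    then have "\<forall>a\<in>fst x \<inter> ?T. \<forall>b\<in>fst x \<inter> ?T. a = b"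
      using disc[OF that(1)] card_le_Suc0_iff_eq by (metis One_nat_def)
    then show ?thesis using that by blast
  qed
  have meets: "\<exists>v. v \<in> fst x \<and> v \<in> ?T" if "x \<in> ?E" "\<not> fst x \<subseteq> S" for x
    using that edges_subset[OF H that(1)] by blast
  have extT: "extf f x = v" if "x \<in> ?E" "v \<in> fst x" "v \<in> ?T" for f x v
    using single[OF that] that by (auto simp: extf_def)
  have restr: "(restrict f ?E', restrict c S) \<in> compatible_pairs S (hg_restrict S H) n"
    if p: "(f, c) \<in> compatible_pairs I H n" and T: "?T \<subseteq> top_sinks I H n (f, c)" for f c
  proof -
    have f: "f \<in> orientations H" and ac: "\<nexists>es. directed_cycle H f es"
      and c: "c \<in> colorings I n" and comp: "compatible H f c"
      using p by (auto simp: compatible_pairs_def acyclic_orientations_def)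
    have "directed_cycle H f es" if cyc: "directed_cycle (hg_restrict S H) (restrict f ?E') es" for es
    proof -
      have es: "es ! i \<in> ?E'" if "i < length es" for i
        using cyc that nth_mem[of i es] by (auto simp: directed_cycle_def)
      have "Suc i mod length es < length es" if "i < length es" for i
        using that by (intro mod_less_divisor) auto
      then show ?thesis
        using cyc es by (auto simp: directed_cycle_def Let_def edges_restrict)
    qed
    then have "restrict f ?E' \<in> acyclic_orientations (hg_restrict S H)"
      using f ac
      by (auto simp: acyclic_orientations_def orientations_def edges_restrict PiE_iff)
    moreover have "restrict c S \<in> colorings S n"
      using c S by (auto simp: colorings_def PiE_iff)
    moreover have "compatible (hg_restrict S H) (restrict f ?E') (restrict c S)"
      unfolding compatible_def
    proof
      fix x assume x: "x \<in> ?E'"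
      then have xH: "x \<in> ?E" "fst x \<subseteq> S" by (auto simp: edges_restrict)
      have "f x \<in> fst x" using f xH by (auto simp: orientations_def PiE_iff)
      moreover have "restrict c S ` fst x = c ` fst x"
        using xH by (intro image_cong) auto
      ultimately show "restrict c S (restrict f ?E' x) = Max (restrict c S ` fst x)"
        using comp x xH by (auto simp: compatible_def)
    qed
    ultimately show ?thesis by (simp add: compatible_pairs_def)
  qed
  have ext: "(extf f, extc c) \<in> compatible_pairs I H n \<and> ?T \<subseteq> top_sinks I H n (extf f, extc c)"
    if p: "(f, c) \<in> compatible_pairs S (hg_restrict S H) n" for f c
  proof -
    have f: "f \<in> orientations (hg_restrict S H)"
      and ac: "\<nexists>es. directed_cycle (hg_restrict S H) f es"
      and c: "c \<in> colorings S n" and comp: "compatible (hg_restrict S H) f c"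
      using p by (auto simp: compatible_pairs_def acyclic_orientations_def)
    have mem: "extf f x \<in> fst x" if x: "x \<in> ?E" for x
    proof (cases "fst x \<subseteq> S")
      case True
      then show ?thesis
        using f x PiE_mem[of f ?E' fst x] by (simp add: extf_def orientations_def edges_restrict)
    next
      case False
      then show ?thesis using meets[OF x] extT[OF x] by metis
    qed
    have orient: "extf f \<in> orientations H"
      using mem by (auto simp: orientations_def PiE_iff extf_def)
    have col: "extc c \<in> colorings I n"
      using c n by (auto simp: colorings_def PiE_iff extc_def)
    have "directed_cycle (hg_restrict S H) f es" if cyc: "directed_cycle H (extf f) es" for es
    proof -
      have es: "es ! i \<in> ?E" if "i < length es" for i
        using cyc that nth_mem[of i es] by (auto simp: directed_cycle_def)
      have nxt: "Suc i mod length es < length es" if "i < length es" for i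
        using that by (intro mod_less_divisor) auto
      \<comment> \<open>No cycle passes through an edge that leaves \<open>S\<close>: such an edge
        selects some \<open>v\<close> outside \<open>S\<close>, and the next edge, which contains
        \<open>v\<close>, would have to select \<open>v\<close> too, contrary to the definition of a
        directed cycle.\<close>
      have sub: "fst (es ! i) \<subseteq> S" if i: "i < length es" for i
      proof (rule ccontr)
        assume "\<not> fst (es ! i) \<subseteq> S"
        then obtain v where v: "v \<in> fst (es ! i)" "v \<in> ?T" using meets[OF es[OF i]] by blast
        then have "extf f (es ! i) = v" using extT[OF es[OF i]] by blast
        then have "v \<in> fst (es ! (Suc i mod length es))"
            "v \<noteq> extf f (es ! (Suc i mod length es))"
          using cyc i by (auto simp: directed_cycle_def Let_def)
        then show False using extT[OF es[OF nxt[OF i]]] v by metis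
      qed
      have eq: "extf f (es ! i) = f (es ! i)" if "i < length es" for i
        using es[OF that] sub[OF that] by (simp add: extf_def)
      have "es ! i \<in> ?E'" if "i < length es" for i
        using es[OF that] sub[OF that] by (simp add: edges_restrict)
      then have "set es \<subseteq> ?E'" by (metis in_set_conv_nth subsetI)
      moreover have "f (es ! i) \<in> fst (es ! (Suc i mod length es)) - {f (es ! (Suc i mod length es))}"
        if i: "i < length es" for i
      proof -
        have "extf f (es ! i)
            \<in> fst (es ! (Suc i mod length es)) - {extf f (es ! (Suc i mod length es))}"
          using cyc i by (auto simp: directed_cycle_def Let_def)
        then show ?thesis using eq[OF i] eq[OF nxt[OF i]] by simp
      qed
      ultimately show ?thesis
        using cyc by (simp add: directed_cycle_def Let_def)
    qed
    then have "extf f \<in> acyclic_orientations H"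
      using orient ac by (auto simp: acyclic_orientations_def)
    moreover have "compatible H (extf f) (extc c)"
      unfolding compatible_def
    proof
      fix x assume x: "x \<in> ?E"
      show "extc c (extf f x) = Max (extc c ` fst x)"
      proof (cases "fst x \<subseteq> S")
        case True
        then have x': "x \<in> ?E'" using x by (simp add: edges_restrict)
        have "extc c ` fst x = c ` fst x"
          using True S by (intro image_cong) (auto simp: extc_def)
        moreover have "extf f x = f x" using True x by (simp add: extf_def)
        moreover have "extc c (f x) = c (f x)"
          using mem[OF x] True S \<open>extf f x = f x\<close> by (auto simp: extc_def)
        ultimately show ?thesis using comp x' by (simp add: compatible_def)
      next
        case False
        then obtain v where v: "v \<in> fst x" "v \<in> ?T" using meets[OF x] by blast
        have "extc c v = n" using v by (simp add: extc_def)
        moreover have "extc c w \<le> n" if "w \<in> fst x" for w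
          using col that edges_subset[OF H x] by (auto simp: colorings_def PiE_iff)
        ultimately have "Max (extc c ` fst x) = n"
          using v finite_fst_edges[OF H x] by (intro Max_eqI) auto
        then show ?thesis using extT[OF x v] \<open>extc c v = n\<close> by simp
      qed
    qed
    moreover have "?T \<subseteq> top_sinks I H n (extf f, extc c)"
      using extT by (auto simp: top_sinks_def extc_def)
    ultimately show ?thesis using col by (simp add: compatible_pairs_def)
  qed
  have inv1: "extf (restrict f ?E') = f \<and> extc (restrict c S) = c"
    if p: "(f, c) \<in> compatible_pairs I H n" and T: "?T \<subseteq> top_sinks I H n (f, c)" for f c
  proof -
    have f: "f \<in> orientations H" and c: "c \<in> colorings I n"
      using p by (auto simp: compatible_pairs_def acyclic_orientations_def)
    have "extf (restrict f ?E') x = f x" for x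
    proof (cases "x \<in> ?E \<and> \<not> fst x \<subseteq> S")
      case True
      then obtain v where v: "v \<in> fst x" "v \<in> ?T" using meets by blast
      then have "f x = v" using T True by (auto simp: top_sinks_def)
      then show ?thesis using extT[of x v] v True by blast
    next
      \<comment> \<open>Either \<open>x\<close> is an edge inside \<open>S\<close>, where
        restricting changes nothing, or it is no edge and both sides are
        \<open>undefined\<close>.\<close>
      case False
      then show ?thesis using f
        by (cases x) (auto simp: extf_def edges_restrict orientations_def PiE_iff extensional_def)
    qed
    moreover have "extc (restrict c S) v = c v" for v
      using c T by (auto simp: extc_def top_sinks_def colorings_def PiE_iff extensional_def)
    ultimately show ?thesis by blast
  qed
  have inv2: "restrict (extf f) ?E' = f \<and> restrict (extc c) S = c"
    if p: "(f, c) \<in> compatible_pairs S (hg_restrict S H) n" for f c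
  proof -
    have f: "f \<in> orientations (hg_restrict S H)" and c: "c \<in> colorings S n"
      using p by (auto simp: compatible_pairs_def acyclic_orientations_def)
    have "restrict (extf f) ?E' x = f x" for x
      using f by (cases x) (auto simp: extf_def restrict_def edges_restrict orientations_def PiE_iff extensional_def)
    moreover have "restrict (extc c) S v = c v" for v
      using c S by (auto simp: extc_def restrict_def colorings_def PiE_iff extensional_def)
    ultimately show ?thesis by blast
  qed
  show ?thesis
  proof (rule bij_betw_byWitness[where f' = "\<lambda>(f, c). (extf f, extc c)"])
    show "(\<lambda>(f, c). (extf f, extc c)) ` compatible_pairs S (hg_restrict S H) n
        \<subseteq> {p \<in> compatible_pairs I H n. ?T \<subseteq> top_sinks I H n p}"
      using ext by fast
  qed (use restr inv1 inv2 in auto)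
qed

text \<open>If \<open>zeta\<close> is 1, this is the bijection above. If it is 0, some edge has two
  vertices outside \<open>S\<close>; it cannot select both, so they are never both top sinks and the
  right-hand side counts nothing.\<close>

lemma card_compatible_pairs_restrict:
  assumes H: "hypergraph I H" and S: "S \<subseteq> I" and n: "n > 0"
  shows "zeta (hg_contract S (I - S) H) * of_nat (card (compatible_pairs S (hg_restrict S H) n))
    = of_nat (card {p \<in> compatible_pairs I H n. I - S \<subseteq> top_sinks I H n p})"
proof (cases "\<forall>e\<in>#H. \<not> e \<subseteq> S \<longrightarrow> card (e \<inter> (I - S)) \<le> 1")
  case True
  have "card (fst x \<inter> (I - S)) \<le> 1" if "x \<in> edges H" for x
  proof (cases "fst x \<subseteq> S")
    case True
    then have "fst x \<inter> (I - S) = {}" by blast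
    then show ?thesis by simp
  next
    case False
    moreover have "fst x \<in># H" using that by (auto simp: edges_def simp flip: count_greater_zero_iff)
    ultimately show ?thesis using True by blast
  qed
  then show ?thesis
    using bij_betw_same_card[OF bij_betw_compatible_pairs_restrict[OF H S n]] True
    by (simp add: zeta_contract)
next
  case False
  then obtain e where e: "e \<in># H" and big: "\<not> card (e \<inter> (I - S)) \<le> 1" by blast
  have "finite (e \<inter> (I - S))" using H by (simp add: hypergraph_def)
  then obtain v w where vw: "v \<in> e \<inter> (I - S)" "w \<in> e \<inter> (I - S)" "v \<noteq> w"
    using big by (metis One_nat_def card_le_Suc0_iff_eq)
  have "(e, 0) \<in> edges H" using e vw by (auto simp: edges_def)
  have "\<not> I - S \<subseteq> top_sinks I H n p" for p
  proof
    assume "I - S \<subseteq> top_sinks I H n p"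
    then have "fst p (e, 0) = v" "fst p (e, 0) = w"
      using vw \<open>(e, 0) \<in> edges H\<close> by (auto simp: top_sinks_def split: prod.splits)
    then show False using vw by simp
  qed
  moreover have "zeta (hg_contract S (I - S) H) = 0" unfolding zeta_contract using False by (rule if_not_P)
  ultimately show ?thesis by simp
qed

section \<open>Inclusion-exclusion over the top sinks\<close>

text \<open>The sum is the expansion of the product of the factors \<open>1 - 1\<close> over
  \<open>M\<close>.\<close>

lemma sum_minus_one_power_Pow:
  assumes "finite M"
  shows "(\<Sum>T\<in>Pow M. (- 1 :: rat) ^ card T) = (if M = {} then 1 else 0)"
proof -
  have "(\<Sum>T\<in>Pow M. (- 1 :: rat) ^ card T) = (\<Prod>v\<in>M. 1 - 1)"
    using assms by (subst prod_diff_conv_sum) simp_all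
  then show ?thesis using assms by (simp add: card_gt_0_iff power_0_left)
qed

lemma card_compatible_pairs_rec:
  assumes H: "hypergraph I H"
  shows "(of_nat (card (compatible_pairs I H n)) :: rat)
    = (\<Sum>S\<in>Pow I. (- 1) ^ card (I - S) * zeta (hg_contract S (I - S) H)
        * of_nat (card (compatible_pairs S (hg_restrict S H) (Suc n))))"
proof -
  let ?A = "compatible_pairs I H (Suc n)" and ?M = "top_sinks I H (Suc n)"
  have fin: "finite I" using H by (simp add: hypergraph_def)
  have finA: "finite ?A" using H by (rule finite_compatible_pairs)
  have MI: "?M p \<subseteq> I" for p by (auto simp: top_sinks_def split: prod.splits)
  have "(\<Sum>S\<in>Pow I. (- 1) ^ card (I - S) * zeta (hg_contract S (I - S) H)
        * of_nat (card (compatible_pairs S (hg_restrict S H) (Suc n))))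
     = (\<Sum>S\<in>Pow I. (- 1 :: rat) ^ card (I - S) * of_nat (card {p \<in> ?A. I - S \<subseteq> ?M p}))"
    by (intro sum.cong refl) (simp add: mult.assoc card_compatible_pairs_restrict[OF H])
  \<comment> \<open>Summing over the complements \<open>T\<close> and then exchanging the sums gives
    each pair the alternating sum over the subsets of its top sinks, so only pairs without top sinks
    survive.\<close>
  also have "\<dots> = (\<Sum>T\<in>Pow I. (- 1) ^ card T * of_nat (card {p \<in> ?A. T \<subseteq> ?M p}))"
    by (rule sum.reindex_bij_witness[where i = "\<lambda>T. I - T" and j = "\<lambda>S. I - S"])
      (auto simp: double_diff)
  also have "\<dots> = (\<Sum>T\<in>Pow I. \<Sum>p\<in>?A. if T \<subseteq> ?M p then (- 1) ^ card T else 0)"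
    using finA by (simp add: sum.inter_filter[symmetric] mult.commute)
  also have "\<dots> = (\<Sum>p\<in>?A. \<Sum>T\<in>Pow I. if T \<subseteq> ?M p then (- 1) ^ card T else 0)"
    by (rule sum.swap)
  also have "\<dots> = (\<Sum>p\<in>?A. if ?M p = {} then 1 else 0)"
  proof (rule sum.cong[OF refl])
    fix p
    have "(\<Sum>T\<in>Pow I. if T \<subseteq> ?M p then (- 1 :: rat) ^ card T else 0)
        = (\<Sum>T\<in>{T \<in> Pow I. T \<subseteq> ?M p}. (- 1) ^ card T)"
      using fin by (intro sum.inter_filter[symmetric]) simp
    also have "{T \<in> Pow I. T \<subseteq> ?M p} = Pow (?M p)" using MI by blast
    finally show "(\<Sum>T\<in>Pow I. if T \<subseteq> ?M p then (- 1 :: rat) ^ card T else 0)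
        = (if ?M p = {} then 1 else 0)"
      using sum_minus_one_power_Pow[OF finite_subset[OF MI fin]] by simp
  qed
  also have "\<dots> = of_nat (card {p \<in> ?A. ?M p = {}})"
    using finA by (simp add: sum.inter_filter[symmetric])
  finally show ?thesis by (simp add: compatible_pairs_Suc_no_top_sinks[OF H])
qed

section \<open>The recursion for the polynomial at negative arguments\<close>

lemma poly_eq_of_nat:
  fixes p q :: "'b :: {idom, ring_char_0} poly"
  assumes "\<And>n. poly p (of_nat n) = poly q (of_nat n)"
  shows "p = q"
proof -
  have "range of_nat \<subseteq> {x. poly (p - q) x = 0}" using assms by auto
  moreover have "infinite (range (of_nat :: nat \<Rightarrow> 'b))"
    by (simp add: finite_image_iff inj_on_def)
  ultimately have "infinite {x. poly (p - q) x = 0}" using finite_subset by blast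
  then show ?thesis using poly_roots_finite[of "p - q"] by auto
qed

text \<open>\<open>chi_Suc\<close> is this identity at natural numbers. Both sides are polynomials
  in \<open>x\<close>, so it extends to all rationals, in particular to negative integers.\<close>

lemma poly_chi_poly_plus_one:
  assumes H: "hypergraph I H"
  shows "poly (chi_poly I H) (x + 1)
    = (\<Sum>S\<in>Pow I. zeta (hg_contract S (I - S) H) * poly (chi_poly S (hg_restrict S H)) x)"
proof -
  have "pcompose (chi_poly I H) [:1, 1:]
      = (\<Sum>S\<in>Pow I. smult (zeta (hg_contract S (I - S) H)) (chi_poly S (hg_restrict S H)))"
  proof (rule poly_eq_of_nat)
    fix n
    have "poly (pcompose (chi_poly I H) [:1, 1:]) (of_nat n) = chi I H (Suc n)"
      using poly_chi_poly[OF H, of "Suc n"] by (simp add: poly_pcompose)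
    also have "\<dots> = (\<Sum>S\<in>Pow I. zeta (hg_contract S (I - S) H) * chi S (hg_restrict S H) n)"
      by (simp add: chi_Suc[OF H] mult.commute)
    finally show "poly (pcompose (chi_poly I H) [:1, 1:]) (of_nat n) = poly (\<Sum>S\<in>Pow I.
        smult (zeta (hg_contract S (I - S) H)) (chi_poly S (hg_restrict S H))) (of_nat n)"
      by (simp add: poly_sum poly_chi_poly[OF hypergraph_restrict[OF H]])
  qed
  from arg_cong[OF this, of "\<lambda>p. poly p x"] show ?thesis
    by (simp add: poly_pcompose poly_sum add.commute)
qed

lemma signed_chi_poly_rec:
  assumes H: "hypergraph I H"
  shows "(- 1) ^ card I * poly (chi_poly I H) (- of_nat n)
    = (\<Sum>S\<in>Pow I. (- 1) ^ card (I - S) * zeta (hg_contract S (I - S) H)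
        * ((- 1) ^ card S * poly (chi_poly S (hg_restrict S H)) (- of_nat (Suc n))))"
proof -
  have fin: "finite I" using H by (simp add: hypergraph_def)
  have sgn: "(- 1 :: rat) ^ card I = (- 1) ^ card (I - S) * (- 1) ^ card S" if "S \<subseteq> I" for S
    using card_Diff_subset[of S I] card_mono[OF fin that] finite_subset[OF that fin] that
    by (simp flip: power_add)
  \<comment> \<open>At \<open>x = -(n + 1)\<close> the shift by one leads back to \<open>-n\<close>,
    so the value at \<open>n\<close> is expressed through values at \<open>n + 1\<close>.\<close>
  have x: "- of_nat n = - of_nat (Suc n) + (1 :: rat)" by simp
  show ?thesis
    unfolding x poly_chi_poly_plus_one[OF H] sum_distrib_left
    by (intro sum.cong refl) (simp add: sgn mult_ac del: of_nat_Suc)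
qed

section \<open>The induction, and the case of one color\<close>

lemma chi_reciprocity:
  assumes "hypergraph I H"
  shows "(- 1) ^ card I * poly (chi_poly I H) (- of_nat n) = of_nat (card (compatible_pairs I H n))"
  using assms
proof (induction "card I" arbitrary: I H n rule: less_induct)
  case less
  note H = \<open>hypergraph I H\<close>
  have fin: "finite I" using H by (simp add: hypergraph_def)
  have "hg_contract I {} H = {#{}#}"
  proof -
    have "{#e \<in># H. \<not> e \<subseteq> I#} = {#}" using H by (auto simp: hypergraph_def)
    then show ?thesis by (simp add: hg_contract_def)
  qed
  then have z1: "zeta (hg_contract I {} H) = 1" by (simp add: zeta_def discrete_hg_def)
  show ?case
  proof (induction n)
    \<comment> \<open>Only the empty set has a decomposition of length 0, and only the empty set can
      be colored with no colors; both sides are 1 or 0 accordingly.\<close>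
    case 0
    show ?case
    proof (cases "I = {}")
      case True
      have "fst x \<noteq> {}" if "x \<in> edges H" for x using that by (auto simp: edges_def)
      then have E: "edges H = {}" using edges_subset[OF H] True by blast
      then have "acyclic_orientations H = {\<lambda>x. undefined}"
        by (auto simp: acyclic_orientations_def orientations_def directed_cycle_def)
      then have "compatible_pairs I H 0 = {(\<lambda>x. undefined, \<lambda>x. undefined)}"
        using E True by (auto simp: compatible_pairs_def compatible_def colorings_def)
      moreover have "decompositions I 0 = {[]}"
        using True by (auto simp: decompositions_def)
      ultimately show ?thesis
        using poly_chi_poly[OF H, of 0] True by (simp add: chi_def iterated_coproduct_def)
    next
      case False
      then have "decompositions I 0 = {}" by (auto simp: decompositions_def)
      moreover have "compatible_pairs I H 0 = {}"
        using False by (auto simp: compatible_pairs_def colorings_def PiE_iff)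
      ultimately show ?thesis using poly_chi_poly[OF H, of 0] by (simp add: chi_def)
    qed
  next
    case (Suc n)
    define g where "g S m = (- 1) ^ card S * poly (chi_poly S (hg_restrict S H)) (- of_nat m)" for S m
    define w :: "'a set \<Rightarrow> nat \<Rightarrow> rat"
      where "w S m = of_nat (card (compatible_pairs S (hg_restrict S H) m))" for S m
    define a where "a S = (- 1) ^ card (I - S) * zeta (hg_contract S (I - S) H)" for S
    \<comment> \<open>The outer hypothesis holds for every number of colors, so it covers the proper
      subsets at \<open>Suc n\<close> as well.\<close>
    have gw: "g S m = w S m" if "S \<in> Pow I - {I}" for S m
      unfolding g_def w_def using that fin
      by (intro less.hyps hypergraph_restrict[OF H] psubset_card_mono) auto
    \<comment> \<open>The term for \<open>S = I\<close> has coefficient 1. Hence the recursion can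
      be solved for the value of \<open>I\<close> at \<open>Suc n\<close>, given its value at
      \<open>n\<close> and those of the proper subsets at \<open>Suc n\<close>.\<close>
    have split: "(\<Sum>S\<in>Pow I. a S * h S) = h I + (\<Sum>S\<in>Pow I - {I}. a S * h S)" for h :: "'a set \<Rightarrow> rat"
      using fin by (subst sum.remove[of _ I]) (simp_all add: a_def z1)
    have "g I n = (\<Sum>S\<in>Pow I. a S * g S (Suc n))"
      using signed_chi_poly_rec[OF H, of n] by (simp add: g_def a_def hg_restrict_self[OF H])
    moreover have "w I n = (\<Sum>S\<in>Pow I. a S * w S (Suc n))"
      using card_compatible_pairs_rec[OF H, of n] by (simp add: w_def a_def hg_restrict_self[OF H])
    moreover have "g I n = w I n" using Suc by (simp add: g_def w_def hg_restrict_self[OF H])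
    ultimately have "g I (Suc n) = w I (Suc n)" using gw by (simp add: split)
    then show ?case by (simp add: g_def w_def hg_restrict_self[OF H])
  qed
qed

text \<open>With one color only the constant coloring exists, and under it every vertex of an edge
  attains the maximum, so compatibility is no constraint.\<close>

lemma compatible_pairs_one:
  assumes H: "hypergraph I H"
  shows "compatible_pairs I H 1 = acyclic_orientations H \<times> {\<lambda>v\<in>I. 1}"
proof -
  have col: "colorings I 1 = {\<lambda>v\<in>I. 1}"
    by (auto simp: colorings_def PiE_iff extensional_def fun_eq_iff simp del: One_nat_def)
  have "compatible H f (\<lambda>v\<in>I. 1)" if "f \<in> acyclic_orientations H" for f
    unfolding compatible_def
  proof
    fix x assume x: "x \<in> edges H"
    have "f x \<in> fst x" using that x by (auto simp: acyclic_orientations_def orientations_def PiE_iff)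
    moreover have "(\<lambda>v\<in>I. 1 :: nat) ` fst x = {1}"
      using edges_subset[OF H x] \<open>f x \<in> fst x\<close> by force
    ultimately show "(\<lambda>v\<in>I. 1 :: nat) (f x) = Max ((\<lambda>v\<in>I. 1) ` fst x)"
      using edges_subset[OF H x] by auto
  qed
  then show ?thesis by (auto simp: compatible_pairs_def col simp del: One_nat_def)
qed

theorem theorem16:
  fixes I :: "'a set" and H :: "'a set multiset"
  assumes "finite I" and "hypergraph I H"
  shows "(\<forall>n::nat. (- 1) ^ card I * poly (chi_poly I H) (- of_nat n) =
            of_nat (card {(f, S). f \<in> acyclic_orientations H \<and> S \<in> colorings I n \<and> compatible H f S})) \<and>
         (- 1) ^ card I * poly (chi_poly I H) (- 1) = of_nat (card (acyclic_orientations H))"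
proof
  show "\<forall>n::nat. (- 1) ^ card I * poly (chi_poly I H) (- of_nat n) =
      of_nat (card {(f, S). f \<in> acyclic_orientations H \<and> S \<in> colorings I n \<and> compatible H f S})"
    using chi_reciprocity[OF assms(2)] unfolding compatible_pairs_def by blast
  show "(- 1) ^ card I * poly (chi_poly I H) (- 1) = of_nat (card (acyclic_orientations H))"
    using chi_reciprocity[OF assms(2), of 1]
    unfolding compatible_pairs_one[OF assms(2)] card_cartesian_product by simp
qed

end
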